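(* Let $q$ be a power of a prime and $m$ be a positive integer. Let $Q = (q^m-1)/(q-1)$, let $N \mid q^m-1$, and let $K_Q$ be the largest divisor of $N$ that is coprime to $Q$. Then $$Z_{q,m,N}(0) = \frac{(q-1)\phi(K_Q)}{qK_Q} \left( \frac{Q}{\gcd(Q, N)}\, \phi(\gcd(Q, N)) + \Delta_0(\gcd(Q, N)) \right).$$
   Context: $\phi$ is Euler's function, $\mu$ the Möbius function, and divisors are positive. Let $\alpha$ be a primitive element of $\mathbb{F}_{q^m}$. For a positive divisor $N$ of $q^m-1$, a non-zero element $\xi \in \mathbb{F}_{q^m}^*$ is called $N$-free if, for any $d \mid N$, $\xi = \gamma^d$ with $\gamma \in \mathbb{F}_{q^m}$ implies $d=1$; equivalently $\xi = \alpha^k$ for some integer $k$ coprime to $N$. For $c \in \mathbb{F}_q$, $Z_{q,m,N}(c)$ denotes the number of $N$-free elements $\xi \in \mathbb{F}_{q^m}^*$ with $\operatorname{Tr}_{\mathbb{F}_{q^m}/\mathbb{F}_q}(\xi) = c$. Let $p$ be the characteristic of $\mathbb{F}_q$ and let $\chi_{q^m}(z) = e^{2\pi\sqrt{-1}\operatorname{Tr}_{\mathbb{F}_{q^m}/\mathbb{F}_p}(z)/p}$ be the canonical additive character of $\mathbb{F}_{q^m}$. For $d \mid q^m-1$ and $k \in \mathbb{Z}$, the $k$-th Gaussian period of type $(d,q^m)$ is $\eta_k^{(d,q^m)} = \sum_{x \in \alpha^k\langle \alpha^d\rangle} \chi_{q^m}(x)$. For $n \mid q^m-1$ put $\Delta_k(n)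 = \sum_{d \mid n} \mu(d)\, \eta_k^{(d,q^m)}$. *)

theory Defs
  imports "HOL-Analysis.Analysis" "HOL-Number_Theory.Number_Theory"
    "HOL-Computational_Algebra.Squarefree"
begin

text \<open>
  The field $F_{q^m}$ is a type of class \<open>finite_field\<close> with \<open>q ^ m\<close> elements. Its subfield $F_q$ is
  the unique one of order \<open>q\<close>, namely \<open>{x. x ^ q = x}\<close>. It enters only through the relative trace,
  which is the sum of the conjugates over $F_q$.
\<close>

definition ff_trace :: "nat \<Rightarrow> nat \<Rightarrow> 'a::finite_field \<Rightarrow> 'a" where
  "ff_trace q m x = (\<Sum>i<m. x ^ (q ^ i))"

definition primitive_element :: "'a::finite_field \<Rightarrow> bool" where
  "primitive_element \<alpha> \<longleftrightarrow> \<alpha> \<noteq> 0 \<and> range (\<lambda>j::int. \<alpha> powi j) = UNIV - {0}"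

definition N_free :: "nat \<Rightarrow> 'a::finite_field \<Rightarrow> bool" where
  "N_free N \<xi> \<longleftrightarrow> \<xi> \<noteq> 0 \<and> (\<forall>d. d dvd N \<longrightarrow> (\<forall>\<gamma>. \<xi> = \<gamma> ^ d \<longrightarrow> d = 1))"

definition Z_count :: "nat \<Rightarrow> nat \<Rightarrow> nat \<Rightarrow> 'a::finite_field \<Rightarrow> nat" where
  "Z_count q m N c = card {\<xi>::'a. N_free N \<xi> \<and> ff_trace q m \<xi> = c}"

text \<open>
  The trace to the prime field is \<open>ff_trace p n\<close> with \<open>CARD('a) = p ^ n\<close>. Its values lie in the prime
  field \<open>{of_nat k | k < p}\<close> of \<open>'a\<close>; the character needs the residue \<open>k\<close> representing the value.
\<close>

definition abs_trace :: "'a::finite_field \<Rightarrow> 'a" where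
  "abs_trace = ff_trace CHAR('a) (multiplicity CHAR('a) CARD('a))"

definition canonical_char :: "'a::finite_field \<Rightarrow> complex" where
  "canonical_char z =
     exp (2 * of_real pi * \<i> * of_nat (THE k. k < CHAR('a) \<and> of_nat k = abs_trace z) / of_nat CHAR('a))"

definition gauss_period :: "'a::finite_field \<Rightarrow> nat \<Rightarrow> int \<Rightarrow> complex" where
  "gauss_period \<alpha> d k =
     (\<Sum>x \<in> (\<lambda>y. \<alpha> powi k * y) ` range (\<lambda>j::int. (\<alpha> ^ d) powi j). canonical_char x)"

definition moebius_mu :: "nat \<Rightarrow> int" where
  "moebius_mu n = (if squarefree n then (- 1) ^ card (prime_factors n) else 0)"

definition Delta :: "'a::finite_field \<Rightarrow> int \<Rightarrow> nat \<Rightarrow> complex" where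
  "Delta \<alpha> k n = (\<Sum>d | d dvd n. of_int (moebius_mu d) * gauss_period \<alpha> d k)"

definition coprime_part :: "nat \<Rightarrow> nat \<Rightarrow> nat" where
  "coprime_part N Q = Max {d. d dvd N \<and> coprime d Q}"

end

theory Submission
  imports Defs
begin

text \<open>
  Write exponents with respect to \<open>\<alpha>\<close>, and let \<open>g = gcd Q N\<close>. The
  multiplicative group of the small field is generated by \<open>\<alpha> ^ Q\<close>, and the
  trace is linear over the small field; so the condition that \<open>\<alpha> ^ k\<close> has
  trace zero depends only on \<open>k\<close> modulo \<open>Q\<close>. Being \<open>N\<close>-free
  means that \<open>k\<close> is coprime to \<open>N\<close>, which amounts to coprimality to
  \<open>g\<close>, again a condition modulo \<open>Q\<close>, together with coprimality to
  \<open>K\<close>. As \<open>K\<close> is coprime to \<open>Q\<close> and divides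
  \<open>q - 1\<close>, each residue class modulo \<open>Q\<close> meeting the first two conditions contains
  \<open>(q - 1) / K * totient K\<close> exponents meeting the last one. This is
  \<open>Z_count_residues\<close>; it produces the factor in front.

  What remains is the number of residues \<open>r < Q\<close> coprime to \<open>g\<close> for
  which \<open>\<alpha> ^ r\<close> has trace zero. Moebius inversion
  (\<open>card_coprime_moebius\<close>) expresses it through the numbers \<open>A d\<close>
  (\<open>trace_zero_count\<close> below) of those \<open>r < Q\<close> that are divisible by
  \<open>d\<close> and for which \<open>\<alpha> ^ r\<close> has trace zero, for \<open>d\<close>
  dividing \<open>g\<close>. A Gaussian period of type \<open>d\<close>, summed coset by coset of
  the multiplicative group of the small field, equals \<open>q * A d - Q / d\<close>, by
  orthogonality of additive characters (\<open>gauss_period_trace_count\<close>). Solving for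
  \<open>A d\<close> and summing against the Moebius function gives \<open>Delta\<close> from the
  periods, and the totient of \<open>g\<close> from the terms \<open>Q / d\<close>.
\<close>

section \<open>The Moebius function and counting residues\<close>

text \<open>
  Only squarefree divisors contribute, and a squarefree divisor is the product of an arbitrary set of
  prime factors of \<open>n\<close>; the sum is therefore the expansion of the product of \<open>1 - 1\<close> over these primes.
\<close>

lemma sum_moebius_mu_dvd:
  assumes "n > 0"
  shows "(\<Sum>d | d dvd n. moebius_mu d) = (if n = 1 then 1 else 0)"
proof -
  let ?P = "prime_factors n"
  have prime: "prime p" if "p \<in> ?P" for p using that by auto
  have pf_prod: "prime_factors (\<Prod>S) = S" if "S \<subseteq> ?P" for S
  proof -
    have fin: "finite S" using that finite_subset by blast
    have pS: "prime p" if "p \<in> S" for p using that \<open>S \<subseteq> ?P\<close> by auto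
    have "0 \<notin> S" using pS[of 0] by auto
    hence "\<Prod>S \<noteq> 0" using fin by (simp add: prod_zero_iff)
    moreover have "p dvd \<Prod>S \<longleftrightarrow> p \<in> S" if p: "prime p" for p
    proof -
      have "p dvd \<Prod>S \<longleftrightarrow> (\<exists>r\<in>S. p dvd r)" using fin p by (rule prime_dvd_prod_iff)
      also have "\<dots> \<longleftrightarrow> p \<in> S" using primes_dvd_imp_eq[OF p pS] by (metis dvd_refl)
      finally show ?thesis .
    qed
    ultimately show ?thesis using pS by (auto simp: prime_factors_dvd)
  qed
  have sq_prod: "squarefree (\<Prod>S)" if "S \<subseteq> ?P" for S
    by (rule squarefree_prod_coprime)
      (use that prime in \<open>auto intro: primes_coprime squarefree_prime\<close>)
  have prod_pf: "\<Prod>(prime_factors d) = d" if "squarefree d" for d :: nat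
  proof -
    have d: "d \<noteq> 0" using that by (intro notI) simp
    have "d = (\<Prod>p\<in>prime_factors d. p ^ multiplicity p d)"
      using d by (simp add: prime_factorization_nat)
    also have "\<dots> = \<Prod>(prime_factors d)"
      using that d by (intro prod.cong) (auto simp: squarefree_factorial_semiring')
    finally show ?thesis by simp
  qed
  have prod_dvd: "\<Prod>S dvd n" if "S \<subseteq> ?P" for S
  proof -
    have "finite S" using that finite_subset by blast
    thus ?thesis using that
    proof (induction S rule: finite_induct)
      case (insert p S)
      have "coprime p (\<Prod>S)"
        by (rule prod_coprime_right) (use insert prime in \<open>auto intro!: primes_coprime\<close>)
      thus ?case using insert by (auto intro!: divides_mult)
    qed auto
  qed
  have "(\<Sum>d | d dvd n. moebius_mu d) = (\<Sum>d | d dvd n \<and> squarefree d. (- 1) ^ card (prime_factors d))"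
    using assms by (intro sum.mono_neutral_cong_right) (auto simp: moebius_mu_def)
  also have "\<dots> = (\<Sum>S\<in>Pow ?P. (- 1) ^ card S)"
  proof (rule sum.reindex_bij_witness[of _ "\<lambda>S. \<Prod>S" prime_factors])
    fix d assume d: "d \<in> {d. d dvd n \<and> squarefree d}"
    show "\<Prod>(prime_factors d) = d" using d prod_pf by auto
    show "prime_factors d \<in> Pow ?P" using d assms dvd_prime_factors by auto
  qed (use pf_prod sq_prod prod_dvd in auto)
  also have "\<dots> = (\<Prod>p\<in>?P. 1 - 1)"
    by (subst prod_diff_conv_sum) auto
  also have "\<dots> = (if n = 1 then 1 else 0)"
    using assms by (auto simp: prime_factorization_empty_iff power_0_left card_eq_0_iff)
  finally show ?thesis .
qed

text \<open>
  The indicator of coprimality to \<open>g\<close> is \<open>\<Sum>d | d dvd gcd r g. moebius_mu d\<close>. This turns a count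
  of coprime residues into counts of multiples, which Gaussian periods can express.
\<close>

lemma card_coprime_moebius:
  fixes A :: "nat set"
  assumes "finite A" "g > 0"
  shows "int (card {r \<in> A. coprime r g}) = (\<Sum>d | d dvd g. moebius_mu d * int (card {r \<in> A. d dvd r}))"
proof -
  have fin: "finite {d. d dvd g}" using assms by simp
  have "int (card {r \<in> A. coprime r g}) = (\<Sum>r\<in>A. if coprime r g then 1 else 0)"
    using assms by (simp add: sum.If_cases Int_def)
  also have "\<dots> = (\<Sum>r\<in>A. \<Sum>d | d dvd gcd r g. moebius_mu d)"
    using assms by (intro sum.cong refl, subst sum_moebius_mu_dvd) (auto simp flip: coprime_iff_gcd_eq_1 One_nat_def)
  also have "\<dots> = (\<Sum>r\<in>A. \<Sum>d | d dvd g. if d dvd r then moebius_mu d else 0)"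
  proof (rule sum.cong[OF refl])
    fix r
    have "{d. d dvd gcd r g} = {d \<in> {d. d dvd g}. d dvd r}" by auto
    thus "(\<Sum>d | d dvd gcd r g. moebius_mu d) =
        (\<Sum>d | d dvd g. if d dvd r then moebius_mu d else 0)"
      using fin by (simp only: sum.inter_filter)
  qed
  also have "\<dots> = (\<Sum>d | d dvd g. \<Sum>r\<in>A. if d dvd r then moebius_mu d else 0)"
    by (rule sum.swap)
  also have "\<dots> = (\<Sum>d | d dvd g. moebius_mu d * int (card {r \<in> A. d dvd r}))"
    using assms by (intro sum.cong refl) (auto simp: sum.If_cases Int_def)
  finally show ?thesis .
qed

text \<open>
  For \<open>b * c\<close> the order of a cyclic group, this sorts a sum over exponents by the cosets of the subgroup
  generated by the \<open>b\<close>-th power of a generator.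
\<close>

lemma sum_lessThan_mult:
  fixes h :: "nat \<Rightarrow> 'b::comm_monoid_add"
  shows "(\<Sum>k<b * c. h k) = (\<Sum>r<b. \<Sum>j<c. h (r + b * j))"
proof -
  have "(\<Sum>k<b * c. h k) = (\<Sum>(r, j)\<in>{..<b} \<times> {..<c}. h (r + b * j))"
  proof (rule sum.reindex_bij_witness[of _ "\<lambda>(r, j). r + b * j" "\<lambda>k. (k mod b, k div b)"])
    fix k assume k: "k \<in> {..<b * c}"
    hence "b > 0" by (cases b) auto
    thus "(k mod b, k div b) \<in> {..<b} \<times> {..<c}"
      using k by (auto simp: less_mult_imp_div_less mult.commute)
  next
    fix x assume x: "x \<in> {..<b} \<times> {..<c}"
    then obtain r j where [simp]: "x = (r, j)" and rj: "r < b" "j < c" by auto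
    have "r + b * j < b * Suc j" using rj by simp
    also have "\<dots> \<le> b * c" using rj by (intro mult_left_mono) auto
    finally show "(case x of (r, j) \<Rightarrow> r + b * j) \<in> {..<b * c}" by simp
  qed auto
  thus ?thesis by (simp add: sum.cartesian_product)
qed

lemma card_lessThan_mult:
  fixes P :: "nat \<Rightarrow> bool"
  shows "card {k. k < b * c \<and> P k} = (\<Sum>r<b. card {j. j < c \<and> P (r + b * j)})"
proof -
  have *: "card {k. k < x \<and> R k} = (\<Sum>k<x. if R k then 1 else 0)" for x and R :: "nat \<Rightarrow> bool"
    by (simp add: sum.If_cases Int_def)
  show ?thesis unfolding * by (rule sum_lessThan_mult)
qed

lemma card_multiples_lessThan:
  fixes d b :: nat
  assumes "d dvd b" "b > 0"
  shows "card {r. r < b \<and> d dvd r} = b div d"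
proof -
  from assms obtain c where c: "b = d * c" "d > 0" by (auto elim!: dvdE)
  have "card {j. j < c \<and> d dvd (r + d * j)} = (if r = 0 then c else 0)" if "r < d" for r
    using that by (auto simp: dvd_add_left_iff dest: dvd_imp_le)
  hence "card {r. r < b \<and> d dvd r} = (\<Sum>r<d. if r = 0 then c else 0)"
    unfolding c(1) card_lessThan_mult by (intro sum.cong) auto
  thus ?thesis using c by simp
qed

lemma card_coprime_lessThan:
  assumes "n > 0"
  shows "card {k. k < n \<and> coprime k n} = totient n"
proof (cases "n = 1")
  case True
  have "{k. k < n \<and> coprime k n} = {0::nat}" using True by auto
  thus ?thesis using True by simp
next
  case False
  have "{k. k < n \<and> coprime k n} = totatives n"
    using False assms by (auto simp: totatives_def order.order_iff_strict intro!: gr0I)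
  thus ?thesis by (simp add: totient_def)
qed

lemma of_nat_div_exact:
  "d dvd n \<Longrightarrow> (of_nat (n div d) :: 'b::field_char_0) = of_nat n / of_nat d"
  by (cases "d = 0") (auto elim!: dvdE)

lemma totient_moebius:
  assumes "g > 0"
  shows "int (totient g) = (\<Sum>d | d dvd g. moebius_mu d * int (g div d))"
proof -
  have "int (totient g) = int (card {r \<in> {..<g}. coprime r g})"
    using card_coprime_lessThan[OF assms] by simp
  also have "\<dots> = (\<Sum>d | d dvd g. moebius_mu d * int (card {r \<in> {..<g}. d dvd r}))"
    using assms by (intro card_coprime_moebius) auto
  also have "\<dots> = (\<Sum>d | d dvd g. moebius_mu d * int (g div d))"
    using card_multiples_lessThan assms by (intro sum.cong refl) simp
  finally show ?thesis .
qed

text \<open>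
  Since \<open>b\<close> is invertible modulo \<open>k\<close>, the progression runs through every residue class modulo \<open>k\<close> once
  in each block of \<open>k\<close> consecutive terms, and there are \<open>c div k\<close> such blocks.
\<close>

lemma card_coprime_progression:
  fixes r b c k :: nat
  assumes "k dvd c" "coprime k b" "c > 0"
  shows "card {j. j < c \<and> coprime (r + b * j) k} = (c div k) * totient k"
proof -
  from assms obtain t where t: "c = k * t" "k > 0" by (auto elim!: dvdE)
  have inj: "inj_on (\<lambda>a. (r + b * a) mod k) {..<k}"
  proof (rule inj_onI)
    fix x y assume xy: "x \<in> {..<k}" "y \<in> {..<k}" "(r + b * x) mod k = (r + b * y) mod k"
    hence "[r + b * x = r + b * y] (mod k)" by (simp add: cong_def)
    hence "[x = y] (mod k)"
      using assms(2) by (simp add: cong_add_lcancel_nat cong_mult_lcancel_nat coprime_commute)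
    thus "x = y" using xy by (simp add: cong_def)
  qed
  have "bij_betw (\<lambda>a. (r + b * a) mod k) {..<k} {..<k}"
    unfolding bij_betw_def using inj t(2)
    by (intro conjI endo_inj_surj) auto
  hence img: "(\<lambda>a. (r + b * a) mod k) ` {..<k} = {..<k}" by (simp add: bij_betw_def)
  have "card {a. a < k \<and> coprime (r + b * a) k} = card {u. u < k \<and> coprime u k}"
  proof (rule bij_betw_same_card[of "\<lambda>a. (r + b * a) mod k"], unfold bij_betw_def, intro conjI)
    show "inj_on (\<lambda>a. (r + b * a) mod k) {a. a < k \<and> coprime (r + b * a) k}"
      by (rule inj_on_subset[OF inj]) auto
    show "(\<lambda>a. (r + b * a) mod k) ` {a. a < k \<and> coprime (r + b * a) k} = {u. u < k \<and> coprime u k}"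
    proof (intro equalityI subsetI)
      fix u assume u: "u \<in> {u. u < k \<and> coprime u k}"
      hence "u \<in> (\<lambda>a. (r + b * a) mod k) ` {..<k}" using img by auto
      thus "u \<in> (\<lambda>a. (r + b * a) mod k) ` {a. a < k \<and> coprime (r + b * a) k}"
        using u by auto
    qed (use t(2) in auto)
  qed
  hence period: "card {a. a < k \<and> coprime (r + b * a) k} = totient k"
    using card_coprime_lessThan t(2) by simp
  have shift: "coprime (r + b * (a + k * i)) k \<longleftrightarrow> coprime (r + b * a) k" for a i
  proof -
    have "[r + b * (a + k * i) = r + b * a] (mod k)"
      using mod_mult_self2[of "r + b * a" k "b * i"] by (simp add: cong_def algebra_simps)
    thus ?thesis by (rule coprime_cong_cong_left)
  qed
  have "card {j. j < c \<and> coprime (r + b * j) k} = (\<Sum>a<k. if coprime (r + b * a) k then t else 0)"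
    unfolding t(1) card_lessThan_mult shift by (intro sum.cong) auto
  also have "\<dots> = t * card {a. a < k \<and> coprime (r + b * a) k}"
    by (simp add: sum.If_cases Int_def)
  finally show ?thesis using period t by simp
qed

section \<open>The largest divisor coprime to a given number\<close>

lemma
  assumes "N > 0"
  shows coprime_part_dvd: "coprime_part N Q dvd N"
    and coprime_coprime_part: "coprime (coprime_part N Q) Q"
    and coprime_part_maximal: "\<And>d. d dvd N \<Longrightarrow> coprime d Q \<Longrightarrow> d \<le> coprime_part N Q"
proof -
  let ?D = "{d. d dvd N \<and> coprime d Q}"
  have fin: "finite ?D" using assms by simp
  moreover have "1 \<in> ?D" by simp
  ultimately have "coprime_part N Q \<in> ?D" unfolding coprime_part_def using Max_in by blast
  thus "coprime_part N Q dvd N" "coprime (coprime_part N Q) Q" by auto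
  show "d \<le> coprime_part N Q" if "d dvd N" "coprime d Q" for d
    unfolding coprime_part_def using fin that by (intro Max_ge) auto
qed

text \<open>
  A prime dividing \<open>N\<close> either divides \<open>Q\<close>, and then \<open>gcd Q N\<close>, or else divides the coprime part, which
  could otherwise be enlarged by that prime.
\<close>

lemma coprime_iff_coprime_parts:
  assumes "N > 0"
  shows "coprime k N \<longleftrightarrow> coprime k (gcd Q N) \<and> coprime k (coprime_part N Q)"
proof
  assume "coprime k N"
  thus "coprime k (gcd Q N) \<and> coprime k (coprime_part N Q)"
    using coprime_part_dvd[OF assms] by (meson coprime_divisors dvd_refl gcd_dvd2)
next
  let ?K = "coprime_part N Q"
  assume *: "coprime k (gcd Q N) \<and> coprime k ?K"
  show "coprime k N"
  proof (rule ccontr)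
    assume "\<not> coprime k N"
    then obtain p where p: "prime p" "p dvd k" "p dvd N"
      by (metis coprime_iff_gcd_eq_1 gcd_dvd1 gcd_dvd2 dvd_trans prime_factor_nat)
    have "\<not> p dvd gcd Q N" "\<not> p dvd ?K"
      using * p by (meson coprime_common_divisor not_prime_unit)+
    hence "\<not> p dvd Q" and pK: "coprime p ?K" using p by (auto intro: prime_imp_coprime)
    hence "coprime p Q" using p prime_imp_coprime by blast
    moreover have "p * ?K dvd N" using p pK coprime_part_dvd[OF assms] by (intro divides_mult)
    ultimately have "p * ?K \<le> ?K"
      using coprime_coprime_part[OF assms] by (intro coprime_part_maximal[OF assms]) auto
    moreover have "?K > 0"
      using coprime_part_dvd[OF assms, of Q] assms by (rule dvd_pos_nat[rotated])
    ultimately show False using prime_gt_1_nat[OF p(1)] by simp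
  qed
qed

section \<open>Relative traces in finite fields\<close>

lemma CHAR_eq_of_card_prime_power:
  assumes "CARD('a::finite_field) = p ^ k" "prime p"
  shows "CHAR('a) = p"
proof -
  have "CHAR('a) dvd p ^ k" using CHAR_dvd_CARD[where ?'a = 'a] assms by simp
  hence "CHAR('a) dvd p" using prime_dvd_power CHAR_prime by blast
  thus ?thesis using assms(2) CHAR_prime primes_dvd_imp_eq by blast
qed

lemma ff_trace_0 [simp]: "q > 0 \<Longrightarrow> ff_trace q m 0 = 0"
  by (simp add: ff_trace_def power_0_left)

lemma ff_trace_add:
  fixes x y :: "'a::finite_field"
  assumes "q = CHAR('a) ^ e"
  shows "ff_trace q m (x + y) = ff_trace q m x + ff_trace q m y"
proof -
  have "(x + y) ^ (q ^ i) = x ^ (q ^ i) + y ^ (q ^ i)" for i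
    using freshmans_dream'[of "q ^ i" "e * i" x y] assms by (simp add: power_mult)
  thus ?thesis by (simp add: ff_trace_def sum.distrib)
qed

lemma power_power_fixed: "c ^ q = c \<Longrightarrow> c ^ (q ^ i) = (c::'a::monoid_mult)"
  by (induction i) (simp_all add: power_mult)

lemma ff_trace_scale:
  fixes c x :: "'a::finite_field"
  assumes "c ^ q = c"
  shows "ff_trace q m (c * x) = c * ff_trace q m x"
  using power_power_fixed[OF assms] by (simp add: ff_trace_def power_mult_distrib sum_distrib_left)

text \<open>
  The Frobenius map permutes the conjugates cyclically, so the relative trace takes its values in the
  subfield of order \<open>q\<close>.
\<close>

lemma ff_trace_power:
  fixes x :: "'a::finite_field"
  assumes "q = CHAR('a) ^ e" "CARD('a) = q ^ m"
  shows "ff_trace q m x ^ q = ff_trace q m x"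
proof -
  have "ff_trace q m x ^ q = (\<Sum>i<m. x ^ (q ^ Suc i))"
    unfolding ff_trace_def
    by (subst freshmans_dream_sum'[OF _ assms(1)]) (simp_all add: power_mult mult.commute flip: power_mult)
  also have "\<dots> = (\<Sum>i<Suc m. x ^ (q ^ i)) - x" by (subst sum.lessThan_Suc_shift) simp
  also have "\<dots> = ff_trace q m x"
    using finite_field_power_card_eq_same[of x] assms(2) by (simp add: ff_trace_def)
  finally show ?thesis .
qed

text \<open>
  Transitivity of the trace in a tower of fields: the exponents below \<open>e * m\<close> are written as
  \<open>j + e * i\<close>.
\<close>

lemma ff_trace_tower:
  fixes x :: "'a::finite_field"
  assumes "p = CHAR('a)"
  shows "ff_trace p (e * m) x = ff_trace p e (ff_trace (p ^ e) m x)"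
proof -
  have "ff_trace p (e * m) x = (\<Sum>j<e. \<Sum>i<m. x ^ (p ^ (j + e * i)))"
    unfolding ff_trace_def by (rule sum_lessThan_mult)
  also have "\<dots> = (\<Sum>j<e. (\<Sum>i<m. x ^ ((p ^ e) ^ i)) ^ (p ^ j))"
  proof (rule sum.cong[OF refl])
    fix j
    have "(\<Sum>i<m. x ^ ((p ^ e) ^ i)) ^ (p ^ j) = (\<Sum>i<m. (x ^ ((p ^ e) ^ i)) ^ (p ^ j))"
      by (rule freshmans_dream_sum') (simp_all add: assms)
    thus "(\<Sum>i<m. x ^ (p ^ (j + e * i))) = (\<Sum>i<m. x ^ ((p ^ e) ^ i)) ^ (p ^ j)"
      by (simp add: power_add mult.commute flip: power_mult)
  qed
  finally show ?thesis by (simp add: ff_trace_def)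
qed

text \<open>
  The trace is a polynomial of degree \<open>p ^ (e - 1)\<close>. On a subfield of order \<open>p ^ e\<close> it therefore
  cannot vanish identically, which makes the canonical character nontrivial.
\<close>

lemma ff_trace_eq_0_bound:
  fixes p e :: nat
  assumes "p > 1" "e > 0"
  shows "card {x::'a::finite_field. ff_trace p e x = 0} \<le> p ^ (e - 1)"
proof -
  define P :: "'a poly" where "P = (\<Sum>j<e. Polynomial.monom 1 (p ^ j))"
  have "Polynomial.coeff P (p ^ (e - 1)) = (\<Sum>j<e. if j = e - 1 then 1 else 0)"
    unfolding P_def coeff_sum using assms by (intro sum.cong) auto
  also have "\<dots> = 1" using assms by simp
  finally have "P \<noteq> 0" by auto
  moreover have "degree P \<le> p ^ (e - 1)"
    unfolding P_def
  proof (rule degree_sum_le)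
    fix j assume "j \<in> {..<e}"
    hence "p ^ j \<le> p ^ (e - 1)" using assms by (intro power_increasing) auto
    thus "degree (Polynomial.monom (1::'a) (p ^ j)) \<le> p ^ (e - 1)"
      using degree_monom_le order_trans by blast
  qed auto
  moreover have "poly P x = ff_trace p e x" for x
    by (simp add: P_def poly_sum poly_monom ff_trace_def)
  ultimately show ?thesis using card_poly_roots_bound[of P] by simp
qed

section \<open>The canonical additive character\<close>

text \<open>
  The values of the absolute trace are fixed by the Frobenius map. This description of its fixed points
  gives them an integer representative, so the definite description in \<open>canonical_char\<close> is meaningful.
\<close>

lemma prime_field_eq:
  "{x::'a::finite_field. x ^ CHAR('a) = x} = of_nat ` {..<CHAR('a)}"
proof (rule sym, rule card_seteq)
  let ?p = "CHAR('a)"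
  have p1: "?p > 1" using prime_gt_1_nat[OF CHAR_prime[where ?'a = 'a]] .
  have pw: "(of_nat k :: 'a) ^ ?p = of_nat k" for k
    by (induction k) (simp_all add: freshmans_dream power_0_left)
  thus "of_nat ` {..<?p} \<subseteq> {x::'a. x ^ ?p = x}" by auto
  have "inj_on (of_nat :: nat \<Rightarrow> 'a) {..<?p}"
  proof (rule linorder_inj_onI)
    fix i j :: nat assume "i < j" "i \<in> {..<?p}" "j \<in> {..<?p}"
    thus "of_nat i \<noteq> (of_nat j :: 'a)"
      by (subst of_nat_eq_iff_char_dvd) (auto dest!: dvd_imp_le)
  qed auto
  hence c: "card (of_nat ` {..<?p} :: 'a set) = ?p" by (simp add: card_image)
  define P :: "'a poly" where "P = Polynomial.monom 1 ?p - Polynomial.monom 1 1"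
  have "Polynomial.coeff P ?p = 1" unfolding P_def using p1 by simp
  hence "P \<noteq> 0" by auto
  moreover have "degree P \<le> ?p"
    unfolding P_def using p1 by (intro degree_diff_le) (auto intro: degree_monom_le order_trans)
  moreover have "poly P x = x ^ ?p - x" for x by (simp add: P_def poly_monom)
  ultimately show "card {x::'a. x ^ ?p = x} \<le> card (of_nat ` {..<?p} :: 'a set)"
    using card_poly_roots_bound[of P] c by simp
qed auto

lemma abs_trace_eq:
  assumes "CARD('a::finite_field) = CHAR('a) ^ n"
  shows "(abs_trace :: 'a \<Rightarrow> 'a) = ff_trace CHAR('a) n"
  using assms by (simp add: abs_trace_def prime_gt_1_nat)

text \<open>
  Any representative of the absolute trace may be used as exponent, reduced modulo the characteristic
  or not; this is what makes the multiplicativity of the character immediate.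
\<close>

lemma canonical_char_eq:
  fixes z :: "'a::finite_field"
  assumes "of_nat k = abs_trace z"
  shows "canonical_char z = exp (2 * of_real pi * \<i> / of_nat CHAR('a)) ^ k"
proof -
  let ?p = "CHAR('a)"
  let ?w = "exp (2 * of_real pi * \<i> / of_nat ?p)"
  have p0: "?p > 0" by simp
  have "?w ^ ?p = exp (of_nat ?p * (2 * of_real pi * \<i> / of_nat ?p))"
    by (rule exp_of_nat_mult[symmetric])
  also have "\<dots> = 1" by simp
  finally have w: "?w ^ ?p = 1" .
  have k: "of_nat (k mod ?p) = abs_trace z" 
    unfolding assms[symmetric] by (simp add: of_nat_eq_iff_cong_CHAR)
  have "(THE k. k < ?p \<and> of_nat k = abs_trace z) = k mod ?p"
  proof (rule the_equality)
    show "k mod ?p < ?p \<and> of_nat (k mod ?p) = abs_trace z" using k by simp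
    fix l assume l: "l < ?p \<and> of_nat l = abs_trace z"
    hence "of_nat l = (of_nat k :: 'a)" using assms by simp
    hence "[l = k] (mod ?p)" by (simp add: of_nat_eq_iff_cong_CHAR)
    thus "l = k mod ?p" using l by (simp add: cong_def)
  qed
  hence "canonical_char z = exp (2 * of_real pi * \<i> * of_nat (k mod ?p) / of_nat ?p)"
    by (simp add: canonical_char_def)
  also have "\<dots> = ?w ^ (k mod ?p)" by (simp add: mult_ac flip: exp_of_nat_mult)
  also have "\<dots> = ?w ^ (k mod ?p + ?p * (k div ?p))" by (simp only: power_add power_mult w) simp
  finally show ?thesis by simp
qed

lemma abs_trace_prime_field:
  fixes z :: "'a::finite_field"
  assumes "CARD('a) = CHAR('a) ^ n"
  obtains k where "k < CHAR('a)" "of_nat k = abs_trace z"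
proof -
  have "abs_trace z ^ CHAR('a) = abs_trace z"
    unfolding abs_trace_eq[OF assms] by (rule ff_trace_power[where e = 1]) (use assms in auto)
  hence "abs_trace z \<in> of_nat ` {..<CHAR('a)}" using prime_field_eq by blast
  thus ?thesis using that by auto
qed

lemma canonical_char_add:
  fixes x y :: "'a::finite_field"
  assumes "CARD('a) = CHAR('a) ^ n"
  shows "canonical_char (x + y) = canonical_char x * canonical_char y"
proof -
  obtain k where k: "of_nat k = abs_trace x" by (rule abs_trace_prime_field[OF assms])
  obtain l where l: "of_nat l = abs_trace y" by (rule abs_trace_prime_field[OF assms])
  have "abs_trace (x + y) = abs_trace x + abs_trace y"
    unfolding abs_trace_eq[OF assms] by (rule ff_trace_add[where e = 1]) simp
  hence "of_nat (k + l) = abs_trace (x + y)" using k l by simp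
  from canonical_char_eq[OF this] canonical_char_eq[OF k] canonical_char_eq[OF l]
  show ?thesis by (simp add: power_add)
qed

lemma canonical_char_eq_1_iff:
  fixes z :: "'a::finite_field"
  assumes "CARD('a) = CHAR('a) ^ n"
  shows "canonical_char z = 1 \<longleftrightarrow> abs_trace z = 0"
proof -
  let ?p = "CHAR('a)"
  obtain k where k: "k < ?p" "of_nat k = abs_trace z" by (rule abs_trace_prime_field[OF assms])
  have "canonical_char z = exp (2 * of_real pi * \<i> * of_nat k / of_nat ?p)"
    using canonical_char_eq[OF k(2)] by (simp add: mult_ac flip: exp_of_nat_mult)
  also have "\<dots> = 1 \<longleftrightarrow> k = 0"
    using complex_root_unity_eq_1[of ?p k] k(1) by (auto dest: dvd_imp_le)
  also have "\<dots> \<longleftrightarrow> abs_trace z = 0"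
    using k by (auto simp: of_nat_eq_0_iff_char_dvd simp flip: k(2) dest: dvd_imp_le)
  finally show ?thesis .
qed

section \<open>Exponents of a primitive element\<close>

text \<open>
  The extension of degree \<open>m\<close> of the field with \<open>q\<close> elements, with a generator of its multiplicative
  group. The group has order \<open>M\<close>, and the multiplicative group of the small field \<open>Fq\<close> is the subgroup
  of order \<open>q - 1\<close> and index \<open>Q\<close>, generated by \<open>\<alpha> ^ Q\<close>.
\<close>

locale primitive_extension =
  fixes \<alpha> :: "'a::finite_field" and q m :: nat
  assumes primepow_q: "primepow q" and m_pos: "m > 0"
    and card_eq: "CARD('a) = q ^ m"
    and primitive: "primitive_element \<alpha>"
begin

definition M :: nat where "M = q ^ m - 1"

definition Q :: nat where "Q = M div (q - 1)"

definition Fq :: "'a set" where "Fq = {c. c ^ q = c}"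

abbreviation tr :: "'a \<Rightarrow> 'a" where "tr \<equiv> ff_trace q m"

lemma q_gt_1: "q > 1"
  using primepow_q primepow_gt_Suc_0 by simp

lemma q_char_power: obtains e where "e > 0" "q = CHAR('a) ^ e"
proof -
  obtain p e where pe: "prime p" "e > 0" "q = p ^ e"
    using primepow_q by (auto simp: primepow_def)
  hence "CARD('a) = p ^ (e * m)" using card_eq by (simp add: power_mult)
  hence "CHAR('a) = p" using pe(1) by (rule CHAR_eq_of_card_prime_power)
  thus ?thesis using that pe by blast
qed

lemma Q_mult: "Q * (q - 1) = M"
proof -
  have "[q = 1] (mod (q - 1))" using q_gt_1 by (simp add: cong_altdef_nat)
  hence "[q ^ m = 1] (mod (q - 1))" using cong_pow by fastforce
  hence "q - 1 dvd M" using q_gt_1 by (simp add: cong_altdef_nat M_def)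
  thus ?thesis by (simp add: Q_def)
qed

lemma M_pos: "M > 0"
  using q_gt_1 m_pos one_less_power[of q m] by (simp add: M_def)

lemma card_eq_Suc: "CARD('a) = Suc M"
  using card_eq M_pos by (simp add: M_def)

lemma Q_pos: "Q > 0"
  using M_pos Q_mult by (metis gr0I mult_0)

lemma alpha_nz: "\<alpha> \<noteq> 0"
  using primitive by (simp add: primitive_element_def)

lemma alpha_power_n: "\<alpha> ^ M = 1"
proof -
  have "\<alpha> * \<alpha> ^ M = \<alpha> ^ CARD('a)"
    by (simp add: card_eq_Suc)
  thus ?thesis using alpha_nz by (simp add: finite_field_power_card_eq_same)
qed

lemma alpha_powi: "\<alpha> powi j = \<alpha> ^ nat (j mod int M)"
proof -
  let ?n = "int M"
  have "\<alpha> powi j = \<alpha> powi (?n * (j div ?n) + j mod ?n)" by simp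
  also have "\<dots> = (\<alpha> powi ?n) powi (j div ?n) * \<alpha> powi (j mod ?n)"
    by (subst power_int_add) (simp_all only: power_int_mult alpha_nz simp_thms)
  also have "\<alpha> powi ?n = 1" using alpha_power_n by (simp only: power_int_of_nat)
  also have "\<alpha> powi (j mod ?n) = \<alpha> ^ nat (j mod ?n)"
    using M_pos by (intro power_int_nonneg_exp) auto
  finally show ?thesis by simp
qed

lemma alpha_image: "(\<lambda>k. \<alpha> ^ k) ` {..<M} = UNIV - {0}"
proof
  show "(\<lambda>k. \<alpha> ^ k) ` {..<M} \<subseteq> UNIV - {0}" using alpha_nz by auto
  show "UNIV - {0} \<subseteq> (\<lambda>k. \<alpha> ^ k) ` {..<M}"
  proof
    fix x :: 'a assume "x \<in> UNIV - {0}"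
    then obtain j :: int where "x = \<alpha> powi j" using primitive unfolding primitive_element_def by blast
    moreover have "nat (j mod int M) < M" using M_pos by (subst nat_less_iff) auto
    ultimately show "x \<in> (\<lambda>k. \<alpha> ^ k) ` {..<M}" using alpha_powi by auto
  qed
qed

lemma alpha_inj: "inj_on (\<lambda>k. \<alpha> ^ k) {..<M}"
  by (rule eq_card_imp_inj_on) (simp_all add: alpha_image card_Diff_singleton card_eq_Suc)

lemma alpha_power_mod: "\<alpha> ^ (k mod M) = \<alpha> ^ k"
proof -
  have "\<alpha> ^ k = \<alpha> ^ (M * (k div M) + k mod M)" by simp
  also have "\<dots> = \<alpha> ^ (k mod M)" by (simp only: power_add power_mult alpha_power_n) simp
  finally show ?thesis by simp
qed

lemma alpha_power_eq_iff: "\<alpha> ^ i = \<alpha> ^ j \<longleftrightarrow> [i = j] (mod M)"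
proof -
  have "\<alpha> ^ i = \<alpha> ^ j \<longleftrightarrow> \<alpha> ^ (i mod M) = \<alpha> ^ (j mod M)"
    by (simp only: alpha_power_mod)
  also have "\<dots> \<longleftrightarrow> i mod M = j mod M"
    using inj_on_eq_iff[OF alpha_inj] M_pos by simp
  finally show ?thesis by (simp add: cong_def)
qed

lemma nonzero_is_power: assumes "x \<noteq> 0" obtains k where "k < M" "x = \<alpha> ^ k"
  using assms alpha_image by (metis DiffI UNIV_I imageE lessThan_iff singletonD)

text \<open>
  If \<open>\<alpha> ^ k\<close> is a \<open>d\<close>-th power \<open>\<alpha> ^ (j * d)\<close> with \<open>d\<close> dividing the group order, then \<open>d\<close> divides \<open>k\<close>.
  Conversely \<open>\<alpha> ^ k\<close> is visibly a power with exponent \<open>gcd k N\<close>.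
\<close>

lemma N_free_power_iff:
  assumes "N dvd M"
  shows "N_free N (\<alpha> ^ k) \<longleftrightarrow> coprime k N"
proof
  assume *: "N_free N (\<alpha> ^ k)"
  have "\<alpha> ^ k = (\<alpha> ^ (k div gcd k N)) ^ gcd k N" by (simp flip: power_mult)
  hence "gcd k N = 1" using * unfolding N_free_def by blast
  thus "coprime k N" by (rule gcd_eq_1_imp_coprime)
next
  assume k: "coprime k N"
  have "d = 1" if d: "d dvd N" and \<gamma>: "\<alpha> ^ k = \<gamma> ^ d" for d \<gamma>
  proof -
    have dn: "d dvd M" using d assms by (rule dvd_trans)
    hence "d > 0" using M_pos by (intro gr0I) auto
    hence "\<gamma> \<noteq> 0" using \<gamma> alpha_nz by (intro notI) (simp add: power_0_left)
    then obtain j where "\<gamma> = \<alpha> ^ j" by (rule nonzero_is_power)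
    hence "[k = j * d] (mod M)" using \<gamma> by (simp add: alpha_power_eq_iff flip: power_mult)
    hence "[k = j * d] (mod d)" using dn by (rule cong_dvd_modulus_nat)
    hence "d dvd k" by (simp add: cong_dvd_iff)
    thus "d = 1" using d k by (metis coprime_common_divisor nat_dvd_1_iff_1)
  qed
  thus "N_free N (\<alpha> ^ k)" using alpha_nz by (auto simp: N_free_def)
qed

lemma Z_count_eq:
  assumes "N dvd M"
  shows "Z_count q m N c = card {k. k < M \<and> coprime k N \<and> tr (\<alpha> ^ k) = c}"
proof -
  let ?A = "{k. k < M \<and> coprime k N \<and> tr (\<alpha> ^ k) = c}"
  have "{\<xi>. N_free N \<xi> \<and> tr \<xi> = c} = (\<lambda>k. \<alpha> ^ k) ` ?A"
  proof (intro equalityI subsetI)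
    fix x assume x: "x \<in> {\<xi>. N_free N \<xi> \<and> tr \<xi> = c}"
    hence "x \<noteq> 0" by (simp add: N_free_def)
    then obtain k where "k < M" "x = \<alpha> ^ k" by (rule nonzero_is_power)
    thus "x \<in> (\<lambda>k. \<alpha> ^ k) ` ?A" using x assms by (auto simp: N_free_power_iff)
  qed (use assms in \<open>auto simp: N_free_power_iff\<close>)
  moreover have "inj_on (\<lambda>k. \<alpha> ^ k) ?A" by (rule inj_on_subset[OF alpha_inj]) auto
  ultimately show ?thesis by (simp add: Z_count_def card_image)
qed

lemma power_in_Fq_iff: "\<alpha> ^ k \<in> Fq \<longleftrightarrow> Q dvd k"
proof -
  have "\<alpha> ^ k \<in> Fq \<longleftrightarrow> [k * q = k] (mod M)"
    by (simp add: Fq_def alpha_power_eq_iff flip: power_mult)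
  also have "\<dots> \<longleftrightarrow> Q * (q - 1) dvd k * (q - 1)"
  proof -
    have "k * q - k = k * (q - 1)" by (simp add: diff_mult_distrib2)
    thus ?thesis using q_gt_1 by (simp add: cong_altdef_nat Q_mult del: One_nat_def)
  qed
  also have "\<dots> \<longleftrightarrow> Q dvd k" using q_gt_1 by simp
  finally show ?thesis .
qed

text \<open>
  The elements of trace zero form a linear space over \<open>Fq\<close>, so whether \<open>\<alpha> ^ k\<close> has trace zero depends
  only on \<open>k\<close> modulo \<open>Q\<close>.
\<close>

lemma tr_shift_eq_0_iff: "tr (\<alpha> ^ (r + Q * j)) = 0 \<longleftrightarrow> tr (\<alpha> ^ r) = 0"
proof -
  have "(\<alpha> ^ (Q * j)) ^ q = \<alpha> ^ (Q * j)" using power_in_Fq_iff[of "Q * j"] by (simp add: Fq_def)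
  from ff_trace_scale[OF this, of m "\<alpha> ^ r"] show ?thesis
    using alpha_nz by (simp add: power_add mult.commute)
qed

lemma inj_on_Fq_powers: "inj_on (\<lambda>j. \<alpha> ^ (Q * j)) {..<q - 1}"
proof (rule inj_onI)
  fix i j assume ij: "i \<in> {..<q - 1}" "j \<in> {..<q - 1}" "\<alpha> ^ (Q * i) = \<alpha> ^ (Q * j)"
  have "Q * i < M" "Q * j < M" using ij Q_pos by (simp_all flip: Q_mult)
  hence "Q * i = Q * j" using ij(3) by (intro inj_onD[OF alpha_inj]) auto
  thus "i = j" using Q_pos by simp
qed

lemma Fq_eq: "Fq = insert 0 ((\<lambda>j. \<alpha> ^ (Q * j)) ` {..<q - 1})"
proof (intro equalityI subsetI)
  fix c assume c: "c \<in> Fq"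
  show "c \<in> insert 0 ((\<lambda>j. \<alpha> ^ (Q * j)) ` {..<q - 1})"
  proof (cases "c = 0")
    case False
    then obtain k where k: "k < M" "c = \<alpha> ^ k" by (rule nonzero_is_power)
    with c power_in_Fq_iff obtain j where "k = Q * j" by auto
    moreover from this have "j < q - 1" using k(1) by (simp flip: Q_mult)
    ultimately show ?thesis using k by auto
  qed auto
next
  fix c assume "c \<in> insert 0 ((\<lambda>j. \<alpha> ^ (Q * j)) ` {..<q - 1})"
  moreover have "0 \<in> Fq" using q_gt_1 by (simp add: Fq_def)
  moreover have "\<alpha> ^ (Q * j) \<in> Fq" for j by (simp only: power_in_Fq_iff) simp
  ultimately show "c \<in> Fq" by blast
qed

lemma sum_Fq: "(\<Sum>c\<in>Fq. h c) = h 0 + (\<Sum>j<q - 1. h (\<alpha> ^ (Q * j)))"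
proof -
  have "0 \<notin> (\<lambda>j. \<alpha> ^ (Q * j)) ` {..<q - 1}" using alpha_nz by auto
  thus ?thesis unfolding Fq_eq by (simp add: sum.reindex[OF inj_on_Fq_powers] o_def del: One_nat_def)
qed

lemma card_Fq: "card Fq = q"
proof -
  have "card Fq = (\<Sum>c\<in>Fq. 1)" by simp
  also have "\<dots> = 1 + (q - 1)" by (subst sum_Fq) simp
  finally show ?thesis using q_gt_1 by simp
qed

lemma card_char_power: obtains n where "CARD('a) = CHAR('a) ^ n"
  by (metis q_char_power card_eq power_mult)

lemma abs_trace_tower:
  assumes "q = CHAR('a) ^ e"
  shows "abs_trace x = ff_trace CHAR('a) e (tr x)"
proof -
  have "CARD('a) = CHAR('a) ^ (e * m)" using card_eq assms by (simp add: power_mult)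
  thus ?thesis by (simp add: abs_trace_eq ff_trace_tower assms)
qed

text \<open>
  Scaling by \<open>z / tr x\<close> moves the relative trace to an arbitrary element \<open>z\<close> of \<open>Fq\<close>, in particular to
  one on which the trace from \<open>Fq\<close> to the prime field does not vanish.
\<close>

lemma abs_trace_scale_nonzero:
  assumes "tr x \<noteq> 0"
  obtains c where "c \<in> Fq" "abs_trace (c * x) \<noteq> 0"
proof -
  obtain e where e: "e > 0" "q = CHAR('a) ^ e" by (rule q_char_power)
  have p1: "CHAR('a) > 1" using prime_gt_1_nat[OF CHAR_prime[where ?'a = 'a]] .
  have "card {z::'a. ff_trace CHAR('a) e z = 0} \<le> CHAR('a) ^ (e - 1)"
    using p1 e(1) by (rule ff_trace_eq_0_bound)
  also have "\<dots> < card Fq" unfolding card_Fq using e p1 by (simp add: power_strict_increasing)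
  finally have "\<not> Fq \<subseteq> {z. ff_trace CHAR('a) e z = 0}" by (meson card_mono finite leD)
  then obtain z where "z \<in> Fq" "ff_trace CHAR('a) e z \<noteq> 0" by blast
  hence z: "z ^ q = z" "ff_trace CHAR('a) e z \<noteq> 0" by (simp_all add: Fq_def)
  have t: "tr x ^ q = tr x" by (rule ff_trace_power[OF e(2) card_eq])
  have c: "(z / tr x) ^ q = z / tr x" using z(1) t by (simp add: power_divide)
  show ?thesis
  proof
    show "z / tr x \<in> Fq" using c by (simp add: Fq_def)
    show "abs_trace (z / tr x * x) \<noteq> 0"
      unfolding abs_trace_tower[OF e(2)] ff_trace_scale[OF c] using assms z(2) by simp
  qed
qed

section \<open>Gaussian periods and elements of trace zero\<close>

text \<open>
  Orthogonality of characters on the additive group \<open>Fq\<close>: the map taking \<open>c\<close> to \<open>canonical_char (c * x)\<close>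
  is trivial if the relative trace of \<open>x\<close> vanishes, and otherwise differs from 1 at some \<open>b\<close>; translating the
  sum by \<open>b\<close> then shows that it is zero.
\<close>

lemma sum_canonical_char_Fq:
  "(\<Sum>c\<in>Fq. canonical_char (c * x)) = (if tr x = 0 then of_nat q else 0)"
proof -
  obtain n where n: "CARD('a) = CHAR('a) ^ n" by (rule card_char_power)
  obtain e where e: "e > 0" "q = CHAR('a) ^ e" by (rule q_char_power)
  show ?thesis
  proof (cases "tr x = 0")
    case True
    have "canonical_char (c * x) = 1" if "c \<in> Fq" for c
    proof -
      have "tr (c * x) = 0" using that True by (simp add: Fq_def ff_trace_scale)
      thus ?thesis by (simp add: canonical_char_eq_1_iff[OF n] abs_trace_tower[OF e(2)])
    qed
    thus ?thesis using True by (simp add: card_Fq)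
  next
    case False
    then obtain b where b: "b \<in> Fq" "abs_trace (b * x) \<noteq> 0" by (rule abs_trace_scale_nonzero)
    let ?S = "\<Sum>c\<in>Fq. canonical_char (c * x)"
    have "?S = (\<Sum>c\<in>Fq. canonical_char ((c + b) * x))"
    proof (rule sum.reindex_bij_witness[of _ "\<lambda>c. c + b" "\<lambda>c. c - b"])
      fix c assume c: "c \<in> Fq"
      show "c + b \<in> Fq"
        using c b(1) freshmans_dream'[OF _ e(2), of c b] by (simp add: Fq_def)
      have "(c - b + b) ^ q = (c - b) ^ q + b ^ q" by (rule freshmans_dream'[OF _ e(2)]) simp
      thus "c - b \<in> Fq" using c b(1) by (simp add: Fq_def eq_diff_eq)
    qed auto
    also have "\<dots> = canonical_char (b * x) * ?S"
      by (simp only: distrib_right canonical_char_add[OF n] sum_distrib_left mult.commute[of _ "canonical_char (b * x)"])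
    finally have "?S * (1 - canonical_char (b * x)) = 0" by (simp add: algebra_simps)
    moreover have "canonical_char (b * x) \<noteq> 1" using b(2) by (simp add: canonical_char_eq_1_iff[OF n])
    ultimately show ?thesis using False by simp
  qed
qed

text \<open>
  Integer exponents are reduced modulo the group order \<open>M\<close>; since \<open>d\<close> divides \<open>M\<close>, this keeps them
  multiples of \<open>d\<close>.
\<close>

lemma gauss_period_eq:
  assumes "d dvd M"
  shows "gauss_period \<alpha> d 0 = (\<Sum>k | k < M \<and> d dvd k. canonical_char (\<alpha> ^ k))"
proof -
  let ?A = "{k. k < M \<and> d dvd k}"
  have "(\<lambda>y. \<alpha> powi 0 * y) ` range (\<lambda>j::int. (\<alpha> ^ d) powi j) = (\<lambda>k. \<alpha> ^ k) ` ?A"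
  proof (intro equalityI subsetI)
    fix x assume "x \<in> (\<lambda>y. \<alpha> powi 0 * y) ` range (\<lambda>j::int. (\<alpha> ^ d) powi j)"
    then obtain j :: int where j: "x = (\<alpha> ^ d) powi j" by auto
    let ?k = "int d * j mod int M"
    have "x = \<alpha> powi (int d * j)" using j by (simp add: power_int_mult)
    hence x: "x = \<alpha> ^ nat ?k" by (simp only: alpha_powi)
    have k: "0 \<le> ?k" "?k < int M" using M_pos by auto
    have "int d dvd ?k" using assms by (simp add: dvd_mod_iff int_dvd_int_iff)
    hence "d dvd nat ?k" using k(1) by (metis int_dvd_int_iff int_nat_eq)
    thus "x \<in> (\<lambda>k. \<alpha> ^ k) ` ?A" using x k by (auto simp: nat_less_iff)
  next
    fix x assume "x \<in> (\<lambda>k. \<alpha> ^ k) ` ?A"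
    then obtain j where "x = \<alpha> ^ (d * j)" by auto
    hence "x = (\<alpha> ^ d) powi int j" by (simp add: power_mult)
    thus "x \<in> (\<lambda>y. \<alpha> powi 0 * y) ` range (\<lambda>j::int. (\<alpha> ^ d) powi j)"
      by (simp del: power_int_of_nat)
  qed
  moreover have "inj_on (\<lambda>k. \<alpha> ^ k) ?A" by (rule inj_on_subset[OF alpha_inj]) auto
  ultimately show ?thesis by (simp add: gauss_period_def sum.reindex)
qed

text \<open>
  The number of cosets of the multiplicative group of \<open>Fq\<close> that consist of \<open>d\<close>-th powers of trace zero,
  for \<open>d\<close> dividing \<open>Q\<close>.
\<close>

definition trace_zero_count :: "nat \<Rightarrow> nat" where
  "trace_zero_count d = card {r. r < Q \<and> d dvd r \<and> tr (\<alpha> ^ r) = 0}"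

text \<open>
  As \<open>d\<close> divides \<open>Q\<close>, the group of \<open>d\<close>-th powers is a union of \<open>Q div d\<close> cosets of the multiplicative
  group of \<open>Fq\<close>. By orthogonality a coset contributes \<open>q - 1\<close> if its elements have trace zero and \<open>-1\<close>
  otherwise.
\<close>

lemma gauss_period_trace_count:
  assumes "d dvd Q"
  shows "gauss_period \<alpha> d 0 = of_nat q * of_nat (trace_zero_count d) - of_nat (Q div d)"
proof -
  let ?\<chi> = "canonical_char :: 'a \<Rightarrow> complex"
  have chi0: "?\<chi> 0 = 1"
    by (metis card_char_power canonical_char_eq_1_iff abs_trace_eq ff_trace_0 CHAR_pos)
  have "d dvd M" using assms by (metis Q_mult dvd_mult2)
  hence "gauss_period \<alpha> d 0 = (\<Sum>k | k < Q * (q - 1) \<and> d dvd k. ?\<chi> (\<alpha> ^ k))"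
    by (simp only: gauss_period_eq Q_mult)
  also have "\<dots> = (\<Sum>k<Q * (q - 1). if d dvd k then ?\<chi> (\<alpha> ^ k) else 0)"
    by (simp add: sum.If_cases Int_def)
  also have "\<dots> = (\<Sum>r<Q. \<Sum>j<q - 1. if d dvd r then ?\<chi> (\<alpha> ^ (Q * j) * \<alpha> ^ r) else 0)"
    using assms by (subst sum_lessThan_mult)
      (simp add: dvd_add_left_iff power_add mult.commute cong: if_cong)
  also have "\<dots> = (\<Sum>r<Q. if d dvd r then (if tr (\<alpha> ^ r) = 0 then of_nat q else 0) - 1 else 0)"
  proof (rule sum.cong[OF refl])
    fix r
    have "(\<Sum>j<q - 1. ?\<chi> (\<alpha> ^ (Q * j) * \<alpha> ^ r)) = (if tr (\<alpha> ^ r) = 0 then of_nat q else 0) - 1"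
      using sum_Fq[of "\<lambda>c. ?\<chi> (c * \<alpha> ^ r)"] sum_canonical_char_Fq[of "\<alpha> ^ r"] chi0
      by (simp add: algebra_simps)
    thus "(\<Sum>j<q - 1. if d dvd r then ?\<chi> (\<alpha> ^ (Q * j) * \<alpha> ^ r) else 0) =
        (if d dvd r then (if tr (\<alpha> ^ r) = 0 then of_nat q else 0) - 1 else 0)" by simp
  qed
  also have "\<dots> = (\<Sum>r<Q. if d dvd r \<and> tr (\<alpha> ^ r) = 0 then of_nat q else 0) -
      (\<Sum>r<Q. if d dvd r then 1 else 0)"
    unfolding sum_subtractf[symmetric] by (intro sum.cong) auto
  also have "\<dots> = of_nat q * of_nat (trace_zero_count d) - of_nat (card {r. r < Q \<and> d dvd r})"
    by (simp add: sum.If_cases Int_def trace_zero_count_def)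
  finally show ?thesis using assms Q_pos by (simp add: card_multiples_lessThan)
qed

text \<open>
  The residue \<open>r\<close> of the exponent modulo \<open>Q\<close> decides both the trace condition and coprimality to
  \<open>gcd Q N\<close>. Within one residue class only coprimality to \<open>K\<close> is left, and \<open>K\<close> divides \<open>q - 1\<close>, so the
  number of solutions is the same for every class.
\<close>

lemma Z_count_residues:
  assumes "N dvd M" and "K = coprime_part N Q"
  shows "Z_count q m N (0::'a) =
    ((q - 1) div K) * totient K * card {r \<in> {r. r < Q \<and> tr (\<alpha> ^ r) = 0}. coprime r (gcd Q N)}"
proof -
  let ?g = "gcd Q N"
  have N: "N > 0" using assms(1) M_pos by (intro gr0I) auto
  have KQ: "coprime K Q" and KN: "K dvd N"
    using coprime_coprime_part[OF N] coprime_part_dvd[OF N] assms(2) by auto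
  have "K dvd Q * (q - 1)" using KN assms(1) by (metis Q_mult dvd_trans)
  hence K: "K dvd q - 1" using KQ by (simp add: coprime_dvd_mult_right_iff)
  have cop: "coprime (r + Q * j) N \<longleftrightarrow> coprime r ?g \<and> coprime (r + Q * j) K" for r j
  proof -
    have "[r + Q * j = r] (mod ?g)" by (simp add: cong_def mod_add_eq mod_mult_left_eq flip: mod_add_right_eq mod_mult_left_eq)
    hence "coprime (r + Q * j) ?g \<longleftrightarrow> coprime r ?g" by (rule coprime_cong_cong_left)
    thus ?thesis using coprime_iff_coprime_parts[OF N, of "r + Q * j" Q] assms(2) by simp
  qed
  have "Z_count q m N (0::'a) = (\<Sum>r<Q. card {j. j < q - 1 \<and> coprime (r + Q * j) N \<and> tr (\<alpha> ^ r) = 0})"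
    unfolding Z_count_eq[OF assms(1)]
    using card_lessThan_mult[of Q "q - 1" "\<lambda>k. coprime k N \<and> tr (\<alpha> ^ k) = 0"]
    by (simp only: Q_mult tr_shift_eq_0_iff)
  also have "\<dots> = (\<Sum>r<Q. if coprime r ?g \<and> tr (\<alpha> ^ r) = 0 then ((q - 1) div K) * totient K else 0)"
  proof (rule sum.cong[OF refl])
    fix r
    show "card {j. j < q - 1 \<and> coprime (r + Q * j) N \<and> tr (\<alpha> ^ r) = 0} =
        (if coprime r ?g \<and> tr (\<alpha> ^ r) = 0 then ((q - 1) div K) * totient K else 0)"
      using card_coprime_progression[OF K KQ, of r] q_gt_1 by (simp add: cop)
  qed
  also have "\<dots> = ((q - 1) div K) * totient K * card {r \<in> {r. r < Q \<and> tr (\<alpha> ^ r) = 0}. coprime r ?g}"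
    by (simp add: sum.If_cases Int_def conj_ac)
  finally show ?thesis .
qed

end

section \<open>The counting formula\<close>

theorem theorem1p3:
  fixes q m N Q K :: nat and \<alpha> :: "'a::finite_field"
  assumes "primepow q" and "m > 0"
    and "CARD('a) = q ^ m"
    and "primitive_element \<alpha>"
    and "N dvd q ^ m - 1"
    and "Q = (q ^ m - 1) div (q - 1)"
    and "K = coprime_part N Q"
  shows "of_nat (Z_count q m N (0::'a)) =
    (of_nat ((q - 1) * totient K) / of_nat (q * K) :: complex) *
    (of_nat Q / of_nat (gcd Q N) * of_nat (totient (gcd Q N)) + Delta \<alpha> 0 (gcd Q N))"
proof -
  interpret E: primitive_extension \<alpha> q m by standard fact+
  have Q: "E.Q = Q" using assms(6) by (simp add: E.Q_def E.M_def)
  have NM: "N dvd E.M" using assms(5) by (simp add: E.M_def)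
  define g where "g = gcd Q N"
  have g: "g > 0" "g dvd Q" using E.Q_pos Q by (auto simp: g_def)
  have N: "N > 0" using NM E.M_pos by (intro gr0I) auto
  have "K > 0" using coprime_part_dvd[OF N, of Q] N assms(7) by (intro gr0I) auto
  have "K dvd Q * (q - 1)"
    using coprime_part_dvd[OF N] NM assms(7) E.Q_mult Q by (metis dvd_trans)
  hence Kq: "K dvd q - 1"
    using coprime_coprime_part[OF N] assms(7) by (simp add: coprime_dvd_mult_right_iff)
  let ?R = "{r \<in> {r. r < Q \<and> ff_trace q m (\<alpha> ^ r) = 0}. coprime r g}"
  have "int (card ?R) = (\<Sum>d | d dvd g. moebius_mu d * int (E.trace_zero_count d))"
    using g(1) by (subst card_coprime_moebius) (auto simp: E.trace_zero_count_def Q conj_ac)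
  hence R: "(of_nat (card ?R) :: complex) = (\<Sum>d | d dvd g. of_int (moebius_mu d) * of_nat (E.trace_zero_count d))"
    by (metis (mono_tags, lifting) of_int_of_nat_eq of_int_sum of_int_mult sum.cong)
  have T: "(of_nat (totient g) :: complex) = (\<Sum>d | d dvd g. of_int (moebius_mu d) * of_nat (g div d))"
    using totient_moebius[OF g(1)]
    by (metis (mono_tags, lifting) of_int_of_nat_eq of_int_sum of_int_mult sum.cong)
  \<comment> \<open>Writing the totient as a divisor sum, too, makes the terms \<open>Q div d\<close> of the Gaussian periods cancel.\<close>
  have "of_nat Q / of_nat g * of_nat (totient g) + Delta \<alpha> 0 g =
      (\<Sum>d | d dvd g. of_int (moebius_mu d) * (of_nat Q / of_nat g * of_nat (g div d) + gauss_period \<alpha> d 0))"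
    unfolding T Delta_def sum_distrib_left sum.distrib[symmetric]
    by (intro sum.cong refl) (simp add: algebra_simps)
  also have "\<dots> = (\<Sum>d | d dvd g. of_int (moebius_mu d) * (of_nat q * of_nat (E.trace_zero_count d)))"
  proof (rule sum.cong[OF refl])
    fix d assume "d \<in> {d. d dvd g}"
    hence d: "d dvd g" "d dvd Q" using g(2) dvd_trans by auto
    have "of_nat Q / of_nat g * of_nat (g div d) = (of_nat (Q div d) :: complex)"
    proof -
      have "(of_nat (g div d) :: complex) = of_nat g / of_nat d"
        "(of_nat (Q div d) :: complex) = of_nat Q / of_nat d"
        using d by (simp_all only: of_nat_div_exact)
      thus ?thesis using g(1) by simp
    qed
    thus "of_int (moebius_mu d) * (of_nat Q / of_nat g * of_nat (g div d) + gauss_period \<alpha> d 0) =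
        of_int (moebius_mu d) * (of_nat q * of_nat (E.trace_zero_count d))"
      using E.gauss_period_trace_count[of d] d(2) Q by simp
  qed
  also have "\<dots> = of_nat q * of_nat (card ?R)"
    unfolding R sum_distrib_left by (intro sum.cong refl) simp
  finally have D: "of_nat Q / of_nat g * of_nat (totient g) + Delta \<alpha> 0 g = of_nat q * of_nat (card ?R)" .
  have "(of_nat (Z_count q m N (0::'a)) :: complex) =
      of_nat ((q - 1) div K) * of_nat (totient K) * of_nat (card ?R)"
    using E.Z_count_residues[OF NM, of K] assms(7)
    unfolding Q g_def by (simp only: of_nat_mult simp_thms)
  also have "of_nat ((q - 1) div K) = (of_nat (q - 1) / of_nat K :: complex)"
    using Kq by (rule of_nat_div_exact)
  finally show ?thesis
    unfolding g_def[symmetric] D using E.q_gt_1 \<open>K > 0\<close> by simp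
qed

end
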